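(* (Right case.) Let $a\in\mathcal{L}$ be such that $a=[a,w]$ for some $w\in\mathcal{L}$. The Yau twist of a multiplicative right hom-Leibniz algebra $(\mathcal{L},[\cdot,\cdot],L_a)$ by $L_a$, that is, the algebra $(\mathcal{L},L_a\circ[\cdot,\cdot],L_a\circ L_a)$, is a multiplicative hom-Lie algebra. (Left case.) Let $a\in\mathcal{L}$ be such that $a=[w,a]$ for some $w\in\mathcal{L}$. The Yau twist of a multiplicative left hom-Leibniz algebra $(\mathcal{L},[\cdot,\cdot],R_a)$ by $R_a$, that is, the algebra $(\mathcal{L},R_a\circ[\cdot,\cdot],R_a\circ R_a)$, is a multiplicative hom-Lie algebra.
   Context: A hom-algebra $(\mathcal{L},[\cdot,\cdot],\alpha)$ is a linear space over a field $\mathbb{F}$ with a bilinear product $[\cdot,\cdot]$ and a linear map $\alpha\colon\mathcal{L}\to\mathcal{L}$; it is multiplicative if $\alpha([x,y])=[\alpha(x),\alpha(y)]$ for all $x,y$. $L_a\colon x\mapsto[a,x]$ and $R_a\colon x\mapsto[x,a]$. It is left hom-Leibniz if $[\alpha(x),[y,z]]=[[x,y],\alpha(z)]+[\alpha(y),[x,z]]$ for all $x,y,z$, and right hom-Leibniz if $[[x,y],\alpha(z)]=[[x,z],\alpha(y)]+[\alpha(x),[y,z]]$ for all $x,y,z$. A hom-Lie algebra is a hom-algebra $(\mathcal{L},[\cdot,\cdot],\alpha)$ with $[x,y]=-[y,x]$ and $[\alpha(x),[y,z]]+[\alpha(y),[z,x]]+[\alpha(z),[x,y]]=0$ for all $x,y,z$.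 *)

theory Defs
  imports Complex_Main
begin

locale hom_algebra = vector_space scale
  for scale :: "'f::field \<Rightarrow> 'v::ab_group_add \<Rightarrow> 'v" +
  fixes br :: "'v \<Rightarrow> 'v \<Rightarrow> 'v"
    and \<alpha> :: "'v \<Rightarrow> 'v"
  assumes br_linear_right: "Vector_Spaces.linear scale scale (\<lambda>y. br x y)"
    and br_linear_left: "Vector_Spaces.linear scale scale (\<lambda>x. br x y)"
    and alpha_linear: "Vector_Spaces.linear scale scale \<alpha>"

locale multiplicative_hom_algebra = hom_algebra +
  assumes alpha_br: "\<alpha> (br x y) = br (\<alpha> x) (\<alpha> y)"

locale left_hom_Leibniz_algebra = hom_algebra +
  assumes left_hom_Leibniz: "br (\<alpha> x) (br y z) = br (br x y) (\<alpha> z) + br (\<alpha> y) (br x z)"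

locale right_hom_Leibniz_algebra = hom_algebra +
  assumes right_hom_Leibniz: "br (br x y) (\<alpha> z) = br (br x z) (\<alpha> y) + br (\<alpha> x) (br y z)"

text \<open>Skew-symmetry is \<open>[x, y] = - [y, x]\<close>; in characteristic 2 this does not force
  \<open>[x, x] = 0\<close>.\<close>

locale hom_Lie_algebra = hom_algebra +
  assumes skew_symmetric: "br x y = - br y x"
    and hom_Jacobi: "br (\<alpha> x) (br y z) + br (\<alpha> y) (br z x) + br (\<alpha> z) (br x y) = 0"

definition left_mult :: "('v \<Rightarrow> 'v \<Rightarrow> 'v) \<Rightarrow> 'v \<Rightarrow> 'v \<Rightarrow> 'v" where
  "left_mult br a = (\<lambda>x. br a x)"

definition right_mult :: "('v \<Rightarrow> 'v \<Rightarrow> 'v) \<Rightarrow> 'v \<Rightarrow> 'v \<Rightarrow> 'v" where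
  "right_mult br a = (\<lambda>x. br x a)"

text \<open>The Yau twist of \<open>(V, br, \<alpha>)\<close> by \<open>\<beta>\<close> is \<open>(V, yau_bracket \<beta> br, yau_map \<beta> \<alpha>)\<close>.\<close>

definition yau_bracket :: "('v \<Rightarrow> 'v) \<Rightarrow> ('v \<Rightarrow> 'v \<Rightarrow> 'v) \<Rightarrow> 'v \<Rightarrow> 'v \<Rightarrow> 'v" where
  "yau_bracket \<beta> br = (\<lambda>x y. \<beta> (br x y))"

definition yau_map :: "('v \<Rightarrow> 'v) \<Rightarrow> ('v \<Rightarrow> 'v) \<Rightarrow> 'v \<Rightarrow> 'v" where
  "yau_map \<beta> \<alpha> = \<beta> \<circ> \<alpha>"

end

theory Submission
  imports Defs
begin

text \<open>
  Write \<open>\<alpha>\<close> for the structure map.  In a right hom-Leibniz algebra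
  \<open>[\<alpha> x, [y, z]] = [[x, y], \<alpha> z] - [[x, z], \<alpha> y]\<close>, and the right-hand side changes sign
  when \<open>y\<close> and \<open>z\<close> are exchanged: left multiplication by an element of the image of \<open>\<alpha>\<close> kills
  every \<open>[y, z] + [z, y]\<close>.  If \<open>\<alpha>\<close> is itself the left multiplication by \<open>a\<close>, then \<open>a = [a, w]\<close>
  says that \<open>a = \<alpha> w\<close> lies in this image, so \<open>\<alpha>\<close> kills every \<open>[y, z] + [z, y]\<close>; this is the
  skew-symmetry of the twisted bracket (lemma \<open>alpha_br_skew\<close>).

  Once the twisted bracket is skew-symmetric, the hom-Leibniz identity turns into the hom-Jacobi
  identity just as a skew-symmetric Leibniz algebra is a Lie algebra; multiplicativity moves all
  occurrences of \<open>\<alpha>\<close> from inside the brackets to the front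
  (lemma \<open>yau_twist_hom_Lie_if_skew\<close>).

  The left case is the right case for the opposite product \<open>x, y \<mapsto> [y, x]\<close>, which exchanges
  left and right multiplications; a product is hom-Lie exactly when its opposite is, because
  the two differ by a sign.
\<close>

lemma (in multiplicative_hom_algebra) yau_twist_multiplicative:
  "multiplicative_hom_algebra scale (yau_bracket \<alpha> br) (yau_map \<alpha> \<alpha>)"
proof (intro multiplicative_hom_algebra.intro hom_algebra.intro vector_space_axioms
    hom_algebra_axioms.intro multiplicative_hom_algebra_axioms.intro)
  show "Vector_Spaces.linear scale scale (yau_bracket \<alpha> br x)" for x
    using Vector_Spaces.linear_compose[OF br_linear_right[of x] alpha_linear]
    by (simp add: yau_bracket_def o_def)
  show "Vector_Spaces.linear scale scale (\<lambda>x. yau_bracket \<alpha> br x y)" for y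
    using Vector_Spaces.linear_compose[OF br_linear_left[of y] alpha_linear]
    by (simp add: yau_bracket_def o_def)
  show "Vector_Spaces.linear scale scale (yau_map \<alpha> \<alpha>)"
    unfolding yau_map_def by (rule Vector_Spaces.linear_compose[OF alpha_linear alpha_linear])
  show "yau_map \<alpha> \<alpha> (yau_bracket \<alpha> br x y) =
      yau_bracket \<alpha> br (yau_map \<alpha> \<alpha> x) (yau_map \<alpha> \<alpha> y)" for x y
    by (simp add: yau_bracket_def yau_map_def alpha_br)
qed

text \<open>
  In the hom-Leibniz identity, solved for \<open>[\<alpha> x, [y, z]]\<close>, the other two terms are exchanged
  by swapping \<open>y\<close> and \<open>z\<close>.
\<close>

lemma (in right_hom_Leibniz_algebra) br_alpha_br_skew:
  "br (\<alpha> x) (br y z) = - br (\<alpha> x) (br z y)"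
  using right_hom_Leibniz[of x y z] right_hom_Leibniz[of x z y]
  by (simp add: eq_neg_iff_add_eq_0 add.commute)

lemma (in right_hom_Leibniz_algebra) alpha_br_skew:
  assumes "\<alpha> = left_mult br a" and "a = br a w"
  shows "\<alpha> (br x y) = - \<alpha> (br y x)"
proof -
  have a: "a = \<alpha> w" and alpha: "\<alpha> u = br a u" for u
    using assms by (simp_all add: left_mult_def)
  show ?thesis
    unfolding alpha using br_alpha_br_skew[of w x y] by (simp flip: a)
qed

text \<open>
  For this bracket hom-Jacobi is \<open>\<alpha>\<^sup>2\<close> applied to the cyclic sum of the terms
  \<open>[\<alpha> x, [y, z]]\<close>, and already \<open>\<alpha>\<close> kills that sum: the hom-Leibniz identity expands its
  first term, and skewness modulo the kernel of \<open>\<alpha>\<close> rewrites the expansion as minus the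
  other two.
\<close>

lemma yau_twist_hom_Lie_if_skew:
  fixes scale :: "'f::field \<Rightarrow> 'v::ab_group_add \<Rightarrow> 'v"
  assumes "multiplicative_hom_algebra scale br \<alpha>"
    and "right_hom_Leibniz_algebra scale br \<alpha>"
    and skew: "\<And>x y. \<alpha> (br x y) = - \<alpha> (br y x)"
  shows "hom_Lie_algebra scale (yau_bracket \<alpha> br) (yau_map \<alpha> \<alpha>)"
proof -
  interpret multiplicative_hom_algebra scale br \<alpha> by fact
  interpret right_hom_Leibniz_algebra scale br \<alpha> by fact
  interpret alpha: Vector_Spaces.linear scale scale \<alpha> by (rule alpha_linear)
  interpret twist: multiplicative_hom_algebra scale "yau_bracket \<alpha> br" "yau_map \<alpha> \<alpha>"
    by (rule yau_twist_multiplicative)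
  have cyclic: "\<alpha> (br (\<alpha> x) (br y z) + br (\<alpha> y) (br z x) + br (\<alpha> z) (br x y)) = 0" for x y z
  proof -
    have "\<alpha> (br (br x y) (\<alpha> z)) = \<alpha> (br (br x z) (\<alpha> y)) + \<alpha> (br (\<alpha> x) (br y z))"
      by (simp add: right_hom_Leibniz[of x y z] alpha.add)
    moreover have "\<alpha> (br (br x y) (\<alpha> z)) = - \<alpha> (br (\<alpha> z) (br x y))"
      by (rule skew)
    moreover have "\<alpha> (br (br x z) (\<alpha> y)) = \<alpha> (br (\<alpha> y) (br z x))"
      by (simp add: skew[of "br x z" "\<alpha> y"] br_alpha_br_skew[of y x z] alpha.neg)
    ultimately show ?thesis
      by (simp add: alpha.add add.commute neg_eq_iff_add_eq_0)
  qed
  show ?thesis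
  proof unfold_locales
    show "yau_bracket \<alpha> br x y = - yau_bracket \<alpha> br y x" for x y
      unfolding yau_bracket_def by (rule skew)
    have "yau_bracket \<alpha> br (yau_map \<alpha> \<alpha> u) (yau_bracket \<alpha> br v t) =
        \<alpha> (\<alpha> (br (\<alpha> u) (br v t)))" for u v t
      by (simp add: yau_bracket_def yau_map_def alpha_br)
    then show "yau_bracket \<alpha> br (yau_map \<alpha> \<alpha> x) (yau_bracket \<alpha> br y z) +
        yau_bracket \<alpha> br (yau_map \<alpha> \<alpha> y) (yau_bracket \<alpha> br z x) +
        yau_bracket \<alpha> br (yau_map \<alpha> \<alpha> z) (yau_bracket \<alpha> br x y) = 0" for x y z
      using cyclic[of x y z] by (simp flip: alpha.add)
  qed
qed

lemma right_hom_Leibniz_yau_twist: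
  fixes scale :: "'f::field \<Rightarrow> 'v::ab_group_add \<Rightarrow> 'v"
  assumes "multiplicative_hom_algebra scale br (left_mult br a)"
    and "right_hom_Leibniz_algebra scale br (left_mult br a)"
    and "a = br a w"
  shows "hom_Lie_algebra scale (yau_bracket (left_mult br a) br)
    (yau_map (left_mult br a) (left_mult br a))"
  using assms
  by (intro yau_twist_hom_Lie_if_skew right_hom_Leibniz_algebra.alpha_br_skew) simp_all

lemma (in hom_algebra) opposite_hom_algebra: "hom_algebra scale (\<lambda>x y. br y x) \<alpha>"
  by (intro hom_algebra.intro vector_space_axioms hom_algebra_axioms.intro
      br_linear_left br_linear_right alpha_linear)

lemma (in multiplicative_hom_algebra) opposite_multiplicative:
  "multiplicative_hom_algebra scale (\<lambda>x y. br y x) \<alpha>"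
  by (intro multiplicative_hom_algebra.intro opposite_hom_algebra
      multiplicative_hom_algebra_axioms.intro alpha_br)

lemma (in left_hom_Leibniz_algebra) opposite_right_hom_Leibniz:
  "right_hom_Leibniz_algebra scale (\<lambda>x y. br y x) \<alpha>"
  by (intro right_hom_Leibniz_algebra.intro opposite_hom_algebra
      right_hom_Leibniz_algebra_axioms.intro)
    (metis left_hom_Leibniz add.commute)

text \<open>
  Skew-symmetry makes the opposite product minus the product, and hom-Jacobi is quadratic in
  the product.
\<close>

lemma (in hom_Lie_algebra) opposite_hom_Lie: "hom_Lie_algebra scale (\<lambda>x y. br y x) \<alpha>"
proof (intro hom_Lie_algebra.intro opposite_hom_algebra hom_Lie_algebra_axioms.intro)
  show "br y x = - br x y" for x y
    by (rule skew_symmetric)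
  have "br (br v u) (\<alpha> t) = br (\<alpha> t) (br u v)" for t u v
  proof -
    interpret Vector_Spaces.linear scale scale "br (\<alpha> t)" by (rule br_linear_right)
    have "br (br v u) (\<alpha> t) = - br (\<alpha> t) (br v u)"
      by (rule skew_symmetric)
    also have "\<dots> = br (\<alpha> t) (br u v)"
      by (simp add: skew_symmetric[of v u] neg)
    finally show ?thesis .
  qed
  then show "br (br z y) (\<alpha> x) + br (br x z) (\<alpha> y) + br (br y x) (\<alpha> z) = 0" for x y z
    using hom_Jacobi by simp
qed

text \<open>
  The right multiplication by \<open>a\<close> is the left multiplication by \<open>a\<close> for the opposite product,
  and the Yau twist of the opposite product is the opposite of the Yau twist.
\<close>

lemma left_hom_Leibniz_yau_twist:
  fixes scale :: "'f::field \<Rightarrow> 'v::ab_group_add \<Rightarrow> 'v"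
  assumes "multiplicative_hom_algebra scale br (right_mult br a)"
    and "left_hom_Leibniz_algebra scale br (right_mult br a)"
    and "a = br w a"
  shows "hom_Lie_algebra scale (yau_bracket (right_mult br a) br)
    (yau_map (right_mult br a) (right_mult br a))"
proof -
  let ?op = "\<lambda>x y. br y x"
  have mult: "left_mult ?op a = right_mult br a"
    by (simp add: left_mult_def right_mult_def)
  have "hom_Lie_algebra scale (yau_bracket (right_mult br a) ?op)
      (yau_map (right_mult br a) (right_mult br a))"
    using right_hom_Leibniz_yau_twist[of scale ?op a w, unfolded mult]
      multiplicative_hom_algebra.opposite_multiplicative[OF assms(1)]
      left_hom_Leibniz_algebra.opposite_right_hom_Leibniz[OF assms(2)] assms(3)
    by blast
  from hom_Lie_algebra.opposite_hom_Lie[OF this] show ?thesis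
    by (simp add: yau_bracket_def)
qed

theorem proposition74:
  fixes scale :: "'f::field \<Rightarrow> 'v::ab_group_add \<Rightarrow> 'v"
    and br :: "'v \<Rightarrow> 'v \<Rightarrow> 'v"
  shows "(\<forall>a. (\<exists>w. a = br a w) \<longrightarrow>
           multiplicative_hom_algebra scale br (left_mult br a) \<longrightarrow>
           right_hom_Leibniz_algebra scale br (left_mult br a) \<longrightarrow>
             multiplicative_hom_algebra scale (yau_bracket (left_mult br a) br)
               (yau_map (left_mult br a) (left_mult br a)) \<and>
             hom_Lie_algebra scale (yau_bracket (left_mult br a) br)
               (yau_map (left_mult br a) (left_mult br a))) \<and>
         (\<forall>a. (\<exists>w. a = br w a) \<longrightarrow>
           multiplicative_hom_algebra scale br (right_mult br a) \<longrightarrow>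
           left_hom_Leibniz_algebra scale br (right_mult br a) \<longrightarrow>
             multiplicative_hom_algebra scale (yau_bracket (right_mult br a) br)
               (yau_map (right_mult br a) (right_mult br a)) \<and>
             hom_Lie_algebra scale (yau_bracket (right_mult br a) br)
               (yau_map (right_mult br a) (right_mult br a)))"
  by (blast intro: multiplicative_hom_algebra.yau_twist_multiplicative
      right_hom_Leibniz_yau_twist left_hom_Leibniz_yau_twist)

end
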